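(* Let a notion of validity for $\mathcal{D}$-valued random variables be given that satisfies E-value monotonicity and continuity from below. Let $\phi$ be a family of tests such that $\varepsilon_\phi:=\sup_{\alpha\in(0,1)}\phi(\alpha)$ exists as a $\mathcal{D}$-valued random variable, and such that there exists an increasing sequence of data-dependent levels $(\widetilde{\alpha}_n)_{n\ge1}$ with $\phi(\widetilde{\alpha}_n)\uparrow\varepsilon_\phi$. Let $\overline{\phi}$ be the closure of $\phi$, given by $\overline{\phi}(\alpha)=d_\alpha\,\mathbb{I}\{\varepsilon_\phi\ge d_\alpha\}$ for $\alpha\in(0,1)$. Then: (i) if $\phi$ is post-hoc valid, then its closure $\overline{\phi}$ is post-hoc valid; (ii) $\overline{\phi}$ is post-hoc valid if and only if its associated E-value $\varepsilon_{\overline{\phi}}:=\sup_{\alpha\in(0,1)}\overline{\phi}(\alpha)$ is valid.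
   Context: $\mathcal{X}$ is the sample space. $\mathcal{D}$ is a totally ordered set with least element $0$ (a non-rejection), containing for each $\alpha\in(0,1)$ an element $d_\alpha$ (the decision to reject at level $\alpha$), such that $d_{\alpha^+}\le d_{\alpha^-}$ whenever $\alpha^-\le\alpha^+$. Suprema of $\mathcal{D}$-valued maps are pointwise, in the order of $\mathcal{D}$; $f_n\uparrow f$ means that $f_n$ is pointwise increasing in $n$ with pointwise supremum $f$. A family of tests $\phi$ is a collection of random variables $\phi(\alpha):\mathcal{X}\to\{0,d_\alpha\}$, $\alpha\in(0,1)$. A data-dependent level is a random variable $\widetilde{\alpha}:\mathcal{X}\to(0,1)$, and $\phi(\widetilde{\alpha})$ denotes the map $x\mapsto\phi(\widetilde{\alpha}(x))(x)$. The symbol $d_\alpha\mathbb{I}\{\cdot\}$ equals $d_\alpha$ on the event and $0$ otherwise. All maps whose validity is discussed are assumed to be ($\mathcal{D}$-valued) random variables. An E-value is a $\mathcal{D}$-valued random variable $\varepsilon:\mathcal{X}\to\mathcal{D}$. No concrete notion of validity is assumed: validity is an abstract property of E-values. A family $\phi$ is valid for $\widetilde{\alpha}$ if the E-value $\phi(\widetilde{\alpha})$ is valid, and $\phi$ is post-hoc valid if it is valid for every data-dependent level $\widetilde{\alpha}$. The two assumed properties of validity are: (E-value monotonicity) if $\varepsilon$ is valid and $\varepsilon'\le\varepsilon$ pointwise, then $\varepsilon'$ is valid; (Continuity from below) if $(\varepsilon_n)_{n\ge1}$ is an increasing sequence of valid $\mathcal{D}$-valued random variables and $\varepsilon=\sup_{n\ge1}\varepsilon_n$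 is a $\mathcal{D}$-valued random variable, then $\varepsilon$ is valid. *)

theory Defs
  imports "HOL-Analysis.Analysis" "HOL-Library.Lub_Glb"
begin

text \<open>
  The sample space is \<open>space M\<close> for a measurable space \<open>M\<close>.  The decision space is a whole type
  \<open>'d :: {linorder, order_bot}\<close>, whose least element \<open>bot\<close> is the non-rejection \<open>0\<close>, with an
  arbitrary \<open>\<sigma>\<close>-algebra given by \<open>D :: 'd measure\<close> with \<open>space D = UNIV\<close>.  E-values are the elements of
  \<open>M \<rightarrow>\<^sub>M D\<close>, and \<open>V :: ('x \<Rightarrow> 'd) \<Rightarrow> bool\<close> is an abstract notion of validity, only ever used on
  elements of \<open>M \<rightarrow>\<^sub>M D\<close>.  The measures of \<open>M\<close> and \<open>D\<close> are irrelevant, only their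
  \<open>\<sigma>\<close>-algebras are used.  The type \<open>'d\<close> need not be complete, so suprema are stated with \<open>isLub\<close>.
\<close>

definition data_dependent_levels :: "'x measure \<Rightarrow> ('x \<Rightarrow> real) set" where
  "data_dependent_levels M = {a \<in> borel_measurable M. \<forall>x\<in>space M. a x \<in> {0<..<1}}"

definition test_family ::
  "'x measure \<Rightarrow> 'd::{linorder,order_bot} measure \<Rightarrow> (real \<Rightarrow> 'd) \<Rightarrow> (real \<Rightarrow> 'x \<Rightarrow> 'd) \<Rightarrow> bool" where
  "test_family M D d \<phi> \<longleftrightarrow>
     (\<forall>\<alpha>\<in>{0<..<1}. \<phi> \<alpha> \<in> M \<rightarrow>\<^sub>M D \<and> (\<forall>x\<in>space M. \<phi> \<alpha> x \<in> {bot, d \<alpha>}))"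

definition at_level :: "(real \<Rightarrow> 'x \<Rightarrow> 'd) \<Rightarrow> ('x \<Rightarrow> real) \<Rightarrow> 'x \<Rightarrow> 'd" where
  "at_level \<phi> a = (\<lambda>x. \<phi> (a x) x)"

definition increases_to :: "'x measure \<Rightarrow> (nat \<Rightarrow> 'x \<Rightarrow> 'd::linorder) \<Rightarrow> ('x \<Rightarrow> 'd) \<Rightarrow> bool" where
  "increases_to M f g \<longleftrightarrow>
     (\<forall>x\<in>space M. incseq (\<lambda>n. f n x) \<and> isLub UNIV (range (\<lambda>n. f n x)) (g x))"

definition evalue_monotone ::
  "'x measure \<Rightarrow> 'd::linorder measure \<Rightarrow> (('x \<Rightarrow> 'd) \<Rightarrow> bool) \<Rightarrow> bool" where
  "evalue_monotone M D V \<longleftrightarrow>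
     (\<forall>\<epsilon>\<in>M \<rightarrow>\<^sub>M D. \<forall>\<epsilon>'\<in>M \<rightarrow>\<^sub>M D. V \<epsilon> \<longrightarrow> (\<forall>x\<in>space M. \<epsilon>' x \<le> \<epsilon> x) \<longrightarrow> V \<epsilon>')"

definition continuous_from_below ::
  "'x measure \<Rightarrow> 'd::linorder measure \<Rightarrow> (('x \<Rightarrow> 'd) \<Rightarrow> bool) \<Rightarrow> bool" where
  "continuous_from_below M D V \<longleftrightarrow>
     (\<forall>\<epsilon>s. \<forall>\<epsilon>\<in>M \<rightarrow>\<^sub>M D.
        (\<forall>n. \<epsilon>s n \<in> M \<rightarrow>\<^sub>M D \<and> V (\<epsilon>s n)) \<longrightarrow> increases_to M \<epsilon>s \<epsilon> \<longrightarrow> V \<epsilon>)"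

definition valid_for ::
  "(('x \<Rightarrow> 'd) \<Rightarrow> bool) \<Rightarrow> (real \<Rightarrow> 'x \<Rightarrow> 'd) \<Rightarrow> ('x \<Rightarrow> real) \<Rightarrow> bool" where
  "valid_for V \<phi> a \<longleftrightarrow> V (at_level \<phi> a)"

definition post_hoc_valid ::
  "'x measure \<Rightarrow> (('x \<Rightarrow> 'd) \<Rightarrow> bool) \<Rightarrow> (real \<Rightarrow> 'x \<Rightarrow> 'd) \<Rightarrow> bool" where
  "post_hoc_valid M V \<phi> \<longleftrightarrow> (\<forall>a\<in>data_dependent_levels M. valid_for V \<phi> a)"

text \<open>
  The associated E-value is the pointwise supremum over all levels; it is meaningful on \<open>space M\<close>
  when \<open>has_assoc_evalue\<close> holds, since least upper bounds in a linear order are unique.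
\<close>

definition assoc_evalue :: "(real \<Rightarrow> 'x \<Rightarrow> 'd::linorder) \<Rightarrow> 'x \<Rightarrow> 'd" where
  "assoc_evalue \<phi> x = (THE s. isLub UNIV ((\<lambda>\<alpha>. \<phi> \<alpha> x) ` {0<..<1}) s)"

definition has_assoc_evalue ::
  "'x measure \<Rightarrow> 'd::linorder measure \<Rightarrow> (real \<Rightarrow> 'x \<Rightarrow> 'd) \<Rightarrow> bool" where
  "has_assoc_evalue M D \<phi> \<longleftrightarrow>
     (\<forall>x\<in>space M. \<exists>s. isLub UNIV ((\<lambda>\<alpha>. \<phi> \<alpha> x) ` {0<..<1}) s) \<and> assoc_evalue \<phi> \<in> M \<rightarrow>\<^sub>M D"

definition closure_family ::
  "(real \<Rightarrow> 'd::{linorder,order_bot}) \<Rightarrow> (real \<Rightarrow> 'x \<Rightarrow> 'd) \<Rightarrow> real \<Rightarrow> 'x \<Rightarrow> 'd" where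
  "closure_family d \<phi> = (\<lambda>\<alpha> x. if d \<alpha> \<le> assoc_evalue \<phi> x then d \<alpha> else bot)"

end

theory Submission
  imports Defs
begin

text \<open>
  Post-hoc validity of \<open>\<phi>\<close> is equivalent to validity of its E-value: every \<open>\<phi>(a)\<close> lies below the
  E-value, and conversely the E-value is the increasing limit of the \<open>\<phi>(a\<^sub>n)\<close>.  Monotonicity extends
  this equivalence to every family squeezed between \<open>\<phi>\<close> and its E-value.  The closure is such a
  family, and hence also has the same E-value as \<open>\<phi>\<close>.
\<close>

text \<open>Existence of a supremum is part of \<open>has_assoc_evalue\<close>, and least upper
  bounds in an order are unique, so the description in \<open>assoc_evalue\<close> denotes
  it.\<close>

lemma isLub_assoc_evalue:
  assumes "has_assoc_evalue M D \<phi>" "x \<in> space M"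
  shows "isLub UNIV ((\<lambda>\<alpha>. \<phi> \<alpha> x) ` {0<..<1}) (assoc_evalue \<phi> x)"
proof -
  obtain s where s: "isLub UNIV ((\<lambda>\<alpha>. \<phi> \<alpha> x) ` {0<..<1}) s"
    using assms unfolding has_assoc_evalue_def by blast
  show ?thesis
    unfolding assoc_evalue_def by (rule theI[of _ s]) (use s isLub_unique in blast)+
qed

lemma assoc_evalue_eqI:
  assumes "isLub UNIV ((\<lambda>\<alpha>. \<phi> \<alpha> x) ` {0<..<1}) s"
  shows "assoc_evalue \<phi> x = s"
  unfolding assoc_evalue_def using assms isLub_unique by (blast intro: the_equality)

lemma le_assoc_evalue:
  assumes "has_assoc_evalue M D \<phi>" "x \<in> space M" "\<alpha> \<in> {0<..<1}"
  shows "\<phi> \<alpha> x \<le> assoc_evalue \<phi> x"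
  using isLub_assoc_evalue[OF assms(1,2)] assms(3) by (auto intro: isLubD2)

text \<open>Raising the values without passing the supremum keeps the supremum: every upper bound of
  \<open>g\<close> also bounds \<open>f\<close>, hence lies above \<open>s\<close>.\<close>

lemma isLub_sandwich:
  fixes f g :: "'i \<Rightarrow> 'd::linorder"
  assumes "isLub UNIV (f ` A) s"
    and "\<And>i. i \<in> A \<Longrightarrow> f i \<le> g i" "\<And>i. i \<in> A \<Longrightarrow> g i \<le> s"
  shows "isLub UNIV (g ` A) s"
proof (rule isLubI2)
  show "isUb UNIV (g ` A) s"
    using assms(3) by (auto intro!: isUbI setleI)
  show "s <=* Collect (isUb UNIV (g ` A))"
  proof (rule setgeI, rule ballI)
    fix u
    assume "u \<in> Collect (isUb UNIV (g ` A))"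
    then have "g i \<le> u" if "i \<in> A" for i
      using that by (auto dest: isUbD)
    then have "isUb UNIV (f ` A) u"
      using assms(2) by (fastforce intro!: isUbI setleI intro: order_trans)
    then show "s \<le> u"
      using assms(1) isLub_le_isUb by blast
  qed
qed

lemma closure_family_le_assoc_evalue:
  "closure_family d \<phi> \<alpha> x \<le> assoc_evalue \<phi> x"
  by (simp add: closure_family_def)

text \<open>A test takes only two values. Where \<phi> rejects, its value \<open>d \<alpha>\<close>
  is below the E-value, so the closure rejects as well.\<close>

lemma le_closure_family:
  assumes "test_family M D d \<phi>" "has_assoc_evalue M D \<phi>" "x \<in> space M" "\<alpha> \<in> {0<..<1}"
  shows "\<phi> \<alpha> x \<le> closure_family d \<phi> \<alpha> x"
proof -
  have "\<phi> \<alpha> x = bot \<or> \<phi> \<alpha> x = d \<alpha>"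
    using assms unfolding test_family_def by blast
  then show ?thesis
    using le_assoc_evalue[OF assms(2-4)] by (auto simp: closure_family_def)
qed

lemma assoc_evalue_closure_family:
  assumes "test_family M D d \<phi>" "has_assoc_evalue M D \<phi>" "x \<in> space M"
  shows "isLub UNIV ((\<lambda>\<alpha>. closure_family d \<phi> \<alpha> x) ` {0<..<1}) (assoc_evalue \<phi> x)"
    and "assoc_evalue (closure_family d \<phi>) x = assoc_evalue \<phi> x"
proof -
  show "isLub UNIV ((\<lambda>\<alpha>. closure_family d \<phi> \<alpha> x) ` {0<..<1}) (assoc_evalue \<phi> x)"
    by (rule isLub_sandwich[OF isLub_assoc_evalue[OF assms(2,3)]])
      (simp_all add: le_closure_family[OF assms] closure_family_le_assoc_evalue)
  then show "assoc_evalue (closure_family d \<phi>) x = assoc_evalue \<phi> x"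
    by (rule assoc_evalue_eqI)
qed

lemma has_assoc_evalue_closure_family:
  assumes "test_family M D d \<phi>" "has_assoc_evalue M D \<phi>"
  shows "has_assoc_evalue M D (closure_family d \<phi>)"
proof -
  \<comment> \<open>Measurability depends only on the values on \<open>space M\<close>, where the
    two suprema agree.\<close>
  have "assoc_evalue (closure_family d \<phi>) \<in> M \<rightarrow>\<^sub>M D \<longleftrightarrow> assoc_evalue \<phi> \<in> M \<rightarrow>\<^sub>M D"
    by (intro measurable_cong assoc_evalue_closure_family(2)[OF assms])
  then show ?thesis
    using assoc_evalue_closure_family(1)[OF assms] assms(2)
    unfolding has_assoc_evalue_def by blast
qed

lemma evalue_monotoneD:
  assumes "evalue_monotone M D V" "V \<epsilon>" "\<epsilon> \<in> M \<rightarrow>\<^sub>M D" "\<epsilon>' \<in> M \<rightarrow>\<^sub>M D"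
    and "\<And>x. x \<in> space M \<Longrightarrow> \<epsilon>' x \<le> \<epsilon> x"
  shows "V \<epsilon>'"
  using assms unfolding evalue_monotone_def by blast

text \<open>Separating \<psi> from \<phi> lets one proof serve both \<phi> itself and its closure,
  while the approximating levels are those given for \<phi>.\<close>

lemma post_hoc_valid_iff_valid_sup:
  assumes mono: "evalue_monotone M D V"
    and cont: "continuous_from_below M D V"
    and \<epsilon>: "\<epsilon> \<in> M \<rightarrow>\<^sub>M D"
    and \<phi>: "\<And>b. b \<in> data_dependent_levels M \<Longrightarrow> at_level \<phi> b \<in> M \<rightarrow>\<^sub>M D"
    and \<psi>: "\<And>b. b \<in> data_dependent_levels M \<Longrightarrow> at_level \<psi> b \<in> M \<rightarrow>\<^sub>M D"
    and lower: "\<And>\<alpha> x. x \<in> space M \<Longrightarrow> \<alpha> \<in> {0<..<1} \<Longrightarrow> \<phi> \<alpha> x \<le> \<psi> \<alpha> x"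
    and upper: "\<And>\<alpha> x. x \<in> space M \<Longrightarrow> \<alpha> \<in> {0<..<1} \<Longrightarrow> \<psi> \<alpha> x \<le> \<epsilon> x"
    and a: "\<And>n. a n \<in> data_dependent_levels M"
    and lim: "increases_to M (\<lambda>n. at_level \<phi> (a n)) \<epsilon>"
  shows "post_hoc_valid M V \<psi> \<longleftrightarrow> V \<epsilon>"
proof
  have level: "b x \<in> {0<..<1}" if "b \<in> data_dependent_levels M" "x \<in> space M" for b x
    using that unfolding data_dependent_levels_def by blast
  show "V \<epsilon>" if "post_hoc_valid M V \<psi>"
  proof -
    \<comment> \<open>Continuity from below has to be applied along \<phi>, since \<open>lim\<close>
      says nothing about monotonicity in n of \<psi> at the levels \<open>a n\<close>. Validity
      therefore first descends from \<psi> to \<phi>.\<close>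
    have "V (at_level \<phi> (a n))" for n
    proof (rule evalue_monotoneD[OF mono _ \<psi>[OF a] \<phi>[OF a]])
      show "V (at_level \<psi> (a n))"
        using that a unfolding post_hoc_valid_def valid_for_def by blast
      show "at_level \<phi> (a n) x \<le> at_level \<psi> (a n) x" if "x \<in> space M" for x
        unfolding at_level_def using that level[OF a] by (intro lower)
    qed
    then show ?thesis
      using cont[unfolded continuous_from_below_def, rule_format, OF \<epsilon> _ lim] \<phi>[OF a] by blast
  qed
  show "post_hoc_valid M V \<psi>" if "V \<epsilon>"
    unfolding post_hoc_valid_def valid_for_def
  proof
    fix b
    assume b: "b \<in> data_dependent_levels M"
    \<comment> \<open>The bound \<open>upper\<close> holds for every level in the unit interval, so
      it survives choosing the level \<open>b x\<close> separately at each x.\<close>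
    show "V (at_level \<psi> b)"
      by (rule evalue_monotoneD[OF mono \<open>V \<epsilon>\<close> \<epsilon> \<psi>[OF b]])
        (simp only: at_level_def upper level[OF b])
  qed
qed

theorem theorem8:
  fixes M :: "'x measure"
    and D :: "'d::{linorder,order_bot} measure"
    and d :: "real \<Rightarrow> 'd"
    and V :: "('x \<Rightarrow> 'd) \<Rightarrow> bool"
    and \<phi> :: "real \<Rightarrow> 'x \<Rightarrow> 'd"
  assumes "space D = UNIV"
    and "antimono_on {0<..<1} d"
    and "evalue_monotone M D V"
    and "continuous_from_below M D V"
    and "test_family M D d \<phi>"
    and "\<forall>b\<in>data_dependent_levels M. at_level \<phi> b \<in> M \<rightarrow>\<^sub>M D"
    and "\<forall>b\<in>data_dependent_levels M. at_level (closure_family d \<phi>) b \<in> M \<rightarrow>\<^sub>M D"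
    and "has_assoc_evalue M D \<phi>"
    and "\<exists>a. (\<forall>n. a n \<in> data_dependent_levels M)
             \<and> (\<forall>x\<in>space M. incseq (\<lambda>n::nat. a n x))
             \<and> increases_to M (\<lambda>n. at_level \<phi> (a n)) (assoc_evalue \<phi>)"
  shows "(post_hoc_valid M V \<phi> \<longrightarrow> post_hoc_valid M V (closure_family d \<phi>)) \<and>
         has_assoc_evalue M D (closure_family d \<phi>) \<and>
         (post_hoc_valid M V (closure_family d \<phi>) \<longleftrightarrow> V (assoc_evalue (closure_family d \<phi>)))"
proof -
  note E = assms(5,8)
  note E' = has_assoc_evalue_closure_family[OF E]
  obtain a where a: "\<And>n. a n \<in> data_dependent_levels M"
    and lim: "increases_to M (\<lambda>n. at_level \<phi> (a n)) (assoc_evalue \<phi>)"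
    using assms(9) by blast
  have meas: "assoc_evalue \<phi> \<in> M \<rightarrow>\<^sub>M D" "assoc_evalue (closure_family d \<phi>) \<in> M \<rightarrow>\<^sub>M D"
    using assms(8) E' unfolding has_assoc_evalue_def by blast+
  note iff = post_hoc_valid_iff_valid_sup[OF assms(3,4) meas(1) bspec[OF assms(6)] _ _ _ a lim]
  have "post_hoc_valid M V \<phi> \<longleftrightarrow> V (assoc_evalue \<phi>)"
    \<comment> \<open>Here \<psi> is \<phi>, and the lower bound is reflexivity.\<close>
    by (rule iff) (use assms(6) le_assoc_evalue[OF assms(8)] in auto)
  moreover have "post_hoc_valid M V (closure_family d \<phi>) \<longleftrightarrow> V (assoc_evalue \<phi>)"
    by (rule iff)
      (use assms(7) le_closure_family[OF E] closure_family_le_assoc_evalue in auto)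
  \<comment> \<open>The two E-values are equal on \<open>space M\<close> only, so transferring validity needs monotonicity.\<close>
  moreover have "V (assoc_evalue (closure_family d \<phi>)) \<longleftrightarrow> V (assoc_evalue \<phi>)"
    using evalue_monotoneD[OF assms(3) _ meas(1,2)] evalue_monotoneD[OF assms(3) _ meas(2,1)]
      assoc_evalue_closure_family(2)[OF E] by fastforce
  ultimately show ?thesis
    using E' by blast
qed

end
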